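(* Let $G$ be a $1$-dimensional finite abstract simplicial complex with connection Laplacian $L$, and let $\zeta_{L^2}(s)=\sum_k \lambda_k^{-s}$, where the $\lambda_k$ are the eigenvalues of $L^2$ counted with multiplicity. Then $\zeta_{L^2}(-s)=\zeta_{L^2}(s)$ for all $s\in\mathbb{C}$.
   Context: A finite abstract simplicial complex $G$ is a finite set of non-empty finite sets (called simplices) closed under taking non-empty subsets. It is $1$-dimensional if every $x\in G$ has cardinality $|x|\le 2$ and at least one $x\in G$ has $|x|=2$. The connection Laplacian $L$ of $G$ is the symmetric $|G|\times|G|$ matrix indexed by the elements of $G$ with $L(x,y)=1$ if $x\cap y\neq\emptyset$ and $L(x,y)=0$ otherwise. It is known that $|\det L|=1$, so $L$ is invertible and $L^2$ is positive definite; powers $\lambda_k^{-s}=e^{-s\log\lambda_k}$ use the real logarithm of $\lambda_k>0$. *)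

theory Defs
  imports Complex_Main "Jordan_Normal_Form.Char_Poly"
begin

definition finite_simplicial_complex :: "'a set set \<Rightarrow> bool" where
  "finite_simplicial_complex G \<longleftrightarrow>
     finite G \<and>
     (\<forall>x\<in>G. finite x \<and> x \<noteq> {}) \<and>
     (\<forall>x\<in>G. \<forall>y. y \<subseteq> x \<and> y \<noteq> {} \<longrightarrow> y \<in> G)"

definition one_dimensional :: "'a set set \<Rightarrow> bool" where
  "one_dimensional G \<longleftrightarrow> (\<forall>x\<in>G. card x \<le> 2) \<and> (\<exists>x\<in>G. card x = 2)"

text \<open>
  Matrices here are indexed by natural numbers, so the connection Laplacian of a complex
  is taken with respect to a list enumerating its simplices without repetition. Another
  enumeration gives a matrix conjugate by a permutation matrix.
\<close>

definition connection_laplacian :: "'a set list \<Rightarrow> real mat" where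
  "connection_laplacian xs =
     mat (length xs) (length xs) (\<lambda>(i, j). if xs ! i \<inter> xs ! j \<noteq> {} then 1 else 0)"

text \<open>
  The sum runs over the multiset of real roots of the characteristic polynomial, that is, over
  the real eigenvalues with algebraic multiplicity. It is meant for symmetric positive definite
  matrices: there, all complex eigenvalues are real and positive, and the algebraic and
  geometric multiplicities coincide. The logarithm is the real one.
\<close>

definition spectral_zeta :: "real mat \<Rightarrow> complex \<Rightarrow> complex" where
  "spectral_zeta A s = (\<Sum>\<mu>\<in>#proots (char_poly A). exp (- s * complex_of_real (ln \<mu>)))"

end

theory Submission imports Defs begin

text \<open>
  Let \<open>S\<close> be the diagonal matrix with entry 1 at vertices and -1 at edges, let \<open>T\<close> be the edge-vertex
  incidence matrix, viewed as a square matrix over all simplices, and let \<open>R\<close> be its transpose. Two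
  distinct edges share at most one vertex, so the entry of \<open>T * R\<close> at two edges tells whether they
  meet, except that it is 2 on the diagonal. Hence \<open>L = S + T + R + T * R\<close>
  (\<open>connection_laplacian_decomposition\<close>).

  Everything else follows from how \<open>S\<close>, \<open>T\<close> and \<open>R\<close> multiply: \<open>S\<close> squares to 1 and is absorbed, up to
  sign, by \<open>T\<close> and \<open>R\<close>, both of which square to 0. With vertices listed before edges, \<open>R\<close> is the upper
  right block and \<open>L = (1 + T) * S * (1 + R)\<close>, so \<open>L\<close> has the explicit inverse
  \<open>N = (1 - R) * S * (1 - T) = S + T + R - R * T\<close>. Put \<open>K = T + R\<close>. Then \<open>K * K = L - N\<close>, the signless
  Hodge Laplacian, and therefore \<open>L * L - 1 = K * (K * L)\<close>, while \<open>(K * L) * K\<close> turns out to be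
  \<open>N * N - 1\<close> conjugated by \<open>S\<close>. Products of two square matrices have the same characteristic
  polynomial in either order, so \<open>L * L\<close> and its inverse \<open>N * N\<close> have the same characteristic
  polynomial (\<open>incidence_form_inverse\<close>).

  The eigenvalues of an inverse matrix are the inverses of the eigenvalues, with multiplicity
  (\<open>proots_char_poly_inverse\<close>). The spectrum of \<open>L * L\<close> is thus stable under \<open>\<lambda> \<mapsto> 1 / \<lambda>\<close>, which changes
  the sign of \<open>ln \<lambda>\<close> and so exchanges the zeta function at \<open>s\<close> and \<open>- s\<close>.
\<close>

section \<open>Characteristic polynomials of products and inverses\<close>

text \<open>
  Both determinants belong to the block matrix with rows \<open>(c, A)\<close> and \<open>(B, 1)\<close>: expanding it gives
  \<open>c - A * B\<close>, and exchanging the two blocks of rows and of columns first gives \<open>c - B * A\<close>.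
  Conjugating \<open>A * B\<close> by \<open>A\<close> would be shorter, but the factor \<open>K\<close> to which this is applied is
  singular for many complexes.
\<close>

lemma det_smult_one_minus_mult_commute:
  fixes A B :: "'a :: idom mat"
  assumes A: "A \<in> carrier_mat n n" and B: "B \<in> carrier_mat n n"
  shows "det (c \<cdot>\<^sub>m 1\<^sub>m n - A * B) = det (c \<cdot>\<^sub>m 1\<^sub>m n - B * A)"
proof -
  let ?I = "1\<^sub>m n :: 'a mat" and ?Z = "0\<^sub>m n n :: 'a mat"
  let ?J = "four_block_mat ?Z ?I ?I ?Z"
  let ?X = "four_block_mat (c \<cdot>\<^sub>m ?I) A B ?I" and ?Y = "four_block_mat ?I B A (c \<cdot>\<^sub>m ?I)"
  have J: "?J \<in> carrier_mat (n + n) (n + n)" by auto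
  have JJ: "?J * ?J = 1\<^sub>m (n + n)"
    by (subst mult_four_block_mat[of _ n n _ n _ n _ _ n _ n]) auto
  have "?J * ?X = four_block_mat B ?I (c \<cdot>\<^sub>m ?I) A"
    using A B by (subst mult_four_block_mat[of _ n n _ n _ n _ _ n _ n]) auto
  moreover have "four_block_mat B ?I (c \<cdot>\<^sub>m ?I) A * ?J = ?Y"
    using A B by (subst mult_four_block_mat[of _ n n _ n _ n _ _ n _ n]) auto
  ultimately have JXJ: "?Y = ?J * ?X * ?J"
    by simp
  have "similar_mat ?Y ?X"
    by (rule similar_matI[of _ _ ?J ?J "n + n"]) (use A B J JJ JXJ in auto)
  then have "det ?Y = det ?X" by (rule det_similar)
  moreover have "det ?X = det (c \<cdot>\<^sub>m ?I - A * B)"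
    using A B by (subst det_four_block_mat[of _ n]) auto
  moreover have "det ?Y = det (c \<cdot>\<^sub>m ?I - B * A)"
    using A B by (subst det_four_block_mat[of _ n]) (auto simp: mult_smult_distrib[of _ n n _ n])
  ultimately show ?thesis by simp
qed

text \<open>
  Reflection is multiplicative, so the roots can be split off one at a time, and the factor
  \<open>a - X\<close> reflects to \<open>a * (X - 1 / a)\<close>.
\<close>

lemma proots_reflect_poly:
  fixes p :: "'a :: field poly"
  assumes "poly p 0 \<noteq> 0"
  shows "proots (reflect_poly p) = image_mset inverse (proots p)"
  using assms
proof (induction p rule: poly_root_induct[where P = "\<lambda>_. True"])
  case 0
  then show ?case by simp
next
  case (no_roots p)
  then have "p \<noteq> 0" by auto
  then have "proots p = {#}"
    using no_roots by (simp flip: set_mset_eq_empty_iff)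
  moreover have "poly (reflect_poly p) x \<noteq> 0" for x
    using no_roots by (cases "x = 0") (auto simp: poly_reflect_poly_nz \<open>p \<noteq> 0\<close>)
  then have "proots (reflect_poly p) = {#}"
    using \<open>p \<noteq> 0\<close> by (simp flip: set_mset_eq_empty_iff)
  ultimately show ?case by simp
next
  case (root a p)
  then have a: "a \<noteq> 0" and p: "p \<noteq> 0" and p0: "poly p 0 \<noteq> 0" by auto
  have 1: "[:a, -1:] = Polynomial.smult (-1) [:-a, 1:]" by simp
  have 2: "reflect_poly [:a, -1:] = Polynomial.smult a [:- inverse a, 1:]"
    using a by (simp add: reflect_poly_def)
  have "proots (reflect_poly ([:a, -1:] * p)) = proots (Polynomial.smult a [:- inverse a, 1:] * reflect_poly p)"
    by (simp only: reflect_poly_mult 2)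
  also have "\<dots> = {#inverse a#} + proots (reflect_poly p)"
    using a p by (subst proots_mult) (simp_all del: smult_pCons)
  also have "\<dots> = image_mset inverse (proots [:a, -1:] + proots p)"
    unfolding 1 using root.IH[OF p0] by (subst proots_smult) simp_all
  also have "proots [:a, -1:] + proots p = proots ([:a, -1:] * p)"
    using p by (subst proots_mult) simp_all
  finally show ?case .
qed

lemma poly_char_poly:
  fixes A :: "'a :: comm_ring_1 mat"
  assumes A: "A \<in> carrier_mat n n"
  shows "poly (char_poly A) t = det (t \<cdot>\<^sub>m 1\<^sub>m n - A)"
  unfolding char_poly_def
  by (rule poly_det_cong[of _ n]) (use A in \<open>auto simp: char_poly_matrix_def\<close>)

text \<open>
  From \<open>A * (t - B) = t * A - 1 = - t * (1 / t - A)\<close>, the characteristic polynomial of \<open>B\<close> is, up to a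
  nonzero constant, the reflection of that of \<open>A\<close>. Comparing polynomials rather than eigenvectors
  gives the algebraic multiplicities directly.
\<close>

lemma proots_char_poly_inverse:
  fixes A B :: "'a :: field_char_0 mat"
  assumes A: "A \<in> carrier_mat n n" and B: "B \<in> carrier_mat n n" and AB: "A * B = 1\<^sub>m n"
  shows "proots (char_poly B) = image_mset inverse (proots (char_poly A))"
proof -
  let ?c = "(-1) ^ n * det A"
  have deg: "degree (char_poly A) = n"
    using degree_monic_char_poly[OF A] by simp
  have "det A * det B = 1"
    using AB det_mult[OF A B] by simp
  then have c: "?c \<noteq> 0" by auto
  have 0: "poly (char_poly A) 0 \<noteq> 0"
  proof -
    have "0 \<cdot>\<^sub>m 1\<^sub>m n - A = (-1) \<cdot>\<^sub>m A" using A by auto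
    then show ?thesis using A c by (simp add: poly_char_poly[OF A])
  qed
  have eval: "poly (reflect_poly (char_poly A)) t = poly (Polynomial.smult ?c (char_poly B)) t" if t: "t \<noteq> 0" for t
  proof -
    have "A * (t \<cdot>\<^sub>m 1\<^sub>m n - B) = t \<cdot>\<^sub>m A - 1\<^sub>m n"
      using A B AB by (simp add: mult_minus_distrib_mat[of _ n n _ n] mult_smult_distrib[of _ n n _ n])
    also have "\<dots> = (- t) \<cdot>\<^sub>m (inverse t \<cdot>\<^sub>m 1\<^sub>m n - A)"
      using A t by (intro eq_matI) (auto simp: field_simps)
    finally have "det (A * (t \<cdot>\<^sub>m 1\<^sub>m n - B)) = (- t) ^ n * poly (char_poly A) (inverse t)"
      using A by (simp add: poly_char_poly[OF A])
    moreover have "det (A * (t \<cdot>\<^sub>m 1\<^sub>m n - B)) = det A * poly (char_poly B) t"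
      using det_mult[OF A minus_carrier_mat[OF B]] by (simp add: poly_char_poly[OF B])
    ultimately have "det A * poly (char_poly B) t = (-1) ^ n * poly (reflect_poly (char_poly A)) t"
      using t by (simp add: poly_reflect_poly_nz deg power_minus[of t])
    then show ?thesis by (simp add: mult.assoc)
  qed
  \<comment> \<open>The factor \<open>X\<close> makes the two sides agree at the excluded point 0 as well.\<close>
  have "poly ([:0, 1:] * reflect_poly (char_poly A)) = poly ([:0, 1:] * Polynomial.smult ?c (char_poly B))"
    using eval by (intro ext) (auto simp del: poly_smult)
  then have "reflect_poly (char_poly A) = Polynomial.smult ?c (char_poly B)"
    unfolding poly_eq_poly_eq_iff by (simp only: mult_cancel_left) simp
  then show ?thesis
    using proots_reflect_poly[OF 0] proots_smult[OF c] by metis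
qed

section \<open>The matrix algebra of signs and incidences\<close>

text \<open>
  By the relations, every product of the three matrices is, up to sign, zero, one, \<open>S\<close>, or an
  alternating word in \<open>T\<close> and \<open>R\<close>. The identities \<open>L * N = 1\<close>, \<open>K * K = L - N\<close> and
  \<open>S * (K * L * K) * S = N * N - 1\<close> are checked by reducing both sides to sums of such words.
\<close>

lemma incidence_form_inverse:
  fixes S T R :: "'a :: field_char_0 mat"
  assumes carr: "S \<in> carrier_mat n n" "T \<in> carrier_mat n n" "R \<in> carrier_mat n n"
    and SS: "S * S = 1\<^sub>m n"
    and T: "S * T = - T" "T * S = T" "T * T = 0\<^sub>m n n"
    and R: "S * R = R" "R * S = - R" "R * R = 0\<^sub>m n n"
  defines "L \<equiv> S + T + R + T * R" and "N \<equiv> S + T + R - R * T"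
  shows "L * N = 1\<^sub>m n" "char_poly (L * L) = char_poly (N * N)"
proof -
  define K where "K = T + R"
  have L: "L \<in> carrier_mat n n" and N: "N \<in> carrier_mat n n" and K: "K \<in> carrier_mat n n"
    using carr by (auto simp: L_def N_def K_def)
  \<comment> \<open>The relations again, in the form they take inside right-nested products.\<close>
  have absorb: "S * (S * X) = X" "S * (T * X) = - (T * X)" "T * (S * X) = T * X"
     "T * (T * X) = 0\<^sub>m n n" "S * (R * X) = R * X" "R * (S * X) = - (R * X)" "R * (R * X) = 0\<^sub>m n n"
    if X: "X \<in> carrier_mat n n" for X
    using that carr SS T R by (simp_all flip: assoc_mult_mat[of _ n n _ n _ n])
  note distr = mult_add_distrib_mat[of _ n n _ n] add_mult_distrib_mat[of _ n n _ _ n]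
    mult_minus_distrib_mat[of _ n n _ n] minus_mult_distrib_mat[of _ n n _ _ n]
    minus_carrier_mat[of _ n n]
  note r = assoc_mult_mat[of _ n n _ n _ n] SS T R absorb distr
  show LN: "L * N = 1\<^sub>m n"
    unfolding L_def N_def using carr
    by (simp add: r, intro eq_matI) (simp_all del: index_mult_mat(1))
  have KK: "K * K = L - N"
    unfolding L_def N_def K_def using carr
    by (simp add: r, intro eq_matI) (simp_all del: index_mult_mat(1))
  have SKLKS: "S * (K * L * K) * S = N * N - 1\<^sub>m n"
    unfolding L_def N_def K_def using carr
    by (simp add: r, intro eq_matI) (simp_all del: index_mult_mat(1))

  have NL: "N * L = 1\<^sub>m n"
    by (rule mat_mult_left_right_inverse[OF L N LN])
  have "K * (K * L) = (K * K) * L"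
    using K L by simp
  also have "\<dots> = L * L - N * L"
    unfolding KK using L N by (rule minus_mult_distrib_mat) (rule L)
  finally have LL: "L * L - 1\<^sub>m n = K * (K * L)"
    by (simp add: NL)
  \<comment> \<open>Shifting \<open>t\<close> by 1 turns \<open>L * L\<close> into the product \<open>K * (K * L)\<close>, whose factors are exchanged.\<close>
  have "poly (char_poly (L * L)) t = poly (char_poly (N * N)) t" for t
  proof -
    have "t \<cdot>\<^sub>m 1\<^sub>m n - L * L = (t - 1) \<cdot>\<^sub>m 1\<^sub>m n - (L * L - 1\<^sub>m n)"
      using L by (intro eq_matI) (auto simp del: index_mult_mat(1))
    then have "det (t \<cdot>\<^sub>m 1\<^sub>m n - L * L) = det ((t - 1) \<cdot>\<^sub>m 1\<^sub>m n - K * (K * L))"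
      by (simp add: LL)
    also have "\<dots> = det ((t - 1) \<cdot>\<^sub>m 1\<^sub>m n - K * L * K)"
      using K L by (intro det_smult_one_minus_mult_commute) auto
    also have "\<dots> = det (S * ((t - 1) \<cdot>\<^sub>m 1\<^sub>m n - K * L * K) * S)"
    proof -
      have "det S * det S = 1"
        using SS det_mult[OF carr(1) carr(1)] by simp
      moreover have "det (S * X * S) = det S * det S * det X" if "X \<in> carrier_mat n n" for X
        using that carr(1) by (simp add: det_mult[of _ n])
      moreover have "(t - 1) \<cdot>\<^sub>m 1\<^sub>m n - K * L * K \<in> carrier_mat n n"
        using K L by (intro minus_carrier_mat) auto
      ultimately show ?thesis by simp
    qed
    also have "S * ((t - 1) \<cdot>\<^sub>m 1\<^sub>m n - K * L * K) * S
        = (t - 1) \<cdot>\<^sub>m 1\<^sub>m n - S * (K * L * K) * S"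
      using K L carr(1) SS
      by (simp add: distr mult_smult_distrib[of _ n n _ n] mult_smult_assoc_mat[of _ n n _ n])
    also have "\<dots> = t \<cdot>\<^sub>m 1\<^sub>m n - N * N"
      unfolding SKLKS using N by (intro eq_matI) (auto simp del: index_mult_mat(1))
    finally show ?thesis
      using L N by (simp add: poly_char_poly[of _ n])
  qed
  then show "char_poly (L * L) = char_poly (N * N)"
    by (intro iffD1[OF poly_eq_poly_eq_iff] ext)
qed

section \<open>The zeta function of a spectrum closed under inversion\<close>

text \<open>
  Inverting an eigenvalue negates its logarithm, which has the same effect on a summand as replacing
  \<open>s\<close> by \<open>- s\<close>. As \<open>ln\<close> is extended to the reals by \<open>ln \<mu> = ln \<bar>\<mu>\<bar>\<close> and \<open>ln 0 = 0\<close>, the rule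
  \<open>ln (inverse \<mu>) = - ln \<mu>\<close> holds for every real \<open>\<mu>\<close>.
\<close>

lemma spectral_zeta_inverse:
  assumes "proots (char_poly A) = image_mset inverse (proots (char_poly A))"
  shows "spectral_zeta A (- s) = spectral_zeta A s"
proof -
  have "spectral_zeta A (- s)
      = (\<Sum>\<mu>\<in>#image_mset inverse (proots (char_poly A)). exp (s * complex_of_real (ln \<mu>)))"
    unfolding spectral_zeta_def by (subst assms) simp
  also have "\<dots> = spectral_zeta A s"
    unfolding spectral_zeta_def by (simp add: multiset.map_comp o_def ln_inverse)
  finally show ?thesis .
qed

section \<open>The connection Laplacian in terms of signs and incidences\<close>

definition sign_matrix :: "'a set list \<Rightarrow> real mat" where
  "sign_matrix xs = mat (length xs) (length xs)
     (\<lambda>(i, j). if i = j then (if card (xs ! i) = 1 then 1 else -1) else 0)"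

text \<open>
  Rows and columns both range over all simplices, with a nonzero entry only if the row is not a
  vertex and the column is one of its vertices. This keeps all matrices square for an arbitrary
  order of the simplices, where the vertices need not come first.
\<close>

definition incidence_matrix :: "'a set list \<Rightarrow> real mat" where
  "incidence_matrix xs = mat (length xs) (length xs)
     (\<lambda>(i, j). if card (xs ! i) \<noteq> 1 \<and> card (xs ! j) = 1 \<and> xs ! j \<subseteq> xs ! i then 1 else 0)"

lemma sign_matrix_mult_index:
  assumes X: "X \<in> carrier_mat (length xs) (length xs)" and i: "i < length xs" and j: "j < length xs"
  shows "(sign_matrix xs * X) $$ (i, j) = (if card (xs ! i) = 1 then 1 else -1) * X $$ (i, j)"
    and "(X * sign_matrix xs) $$ (i, j) = (if card (xs ! j) = 1 then 1 else -1) * X $$ (i, j)"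
proof -
  let ?\<sigma> = "\<lambda>i. if card (xs ! i) = 1 then 1 else -1 :: real"
  have "(sign_matrix xs * X) $$ (i, j) = (\<Sum>k\<in>{0..<length xs}. sign_matrix xs $$ (i, k) * X $$ (k, j))"
    using X i j by (simp add: sign_matrix_def scalar_prod_def)
  also have "\<dots> = (\<Sum>k\<in>{0..<length xs}. if k = i then ?\<sigma> i * X $$ (i, j) else 0)"
    using i by (intro sum.cong) (auto simp: sign_matrix_def)
  finally show "(sign_matrix xs * X) $$ (i, j) = ?\<sigma> i * X $$ (i, j)"
    using i by simp
  have "(X * sign_matrix xs) $$ (i, j) = (\<Sum>k\<in>{0..<length xs}. X $$ (i, k) * sign_matrix xs $$ (k, j))"
    using X i j by (simp add: sign_matrix_def scalar_prod_def)
  also have "\<dots> = (\<Sum>k\<in>{0..<length xs}. if k = j then ?\<sigma> j * X $$ (i, j) else 0)"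
    using j by (intro sum.cong) (auto simp: sign_matrix_def)
  finally show "(X * sign_matrix xs) $$ (i, j) = ?\<sigma> j * X $$ (i, j)"
    using j by simp
qed

lemma sign_matrix_relations:
  fixes xs :: "'a set list"
  defines "S \<equiv> sign_matrix xs" and "T \<equiv> incidence_matrix xs" and "n \<equiv> length xs"
  shows "S * S = 1\<^sub>m n" "S * T = - T" "T * S = T" "T * T = 0\<^sub>m n n"
proof -
  have S: "S \<in> carrier_mat n n" and T: "T \<in> carrier_mat n n"
    by (simp_all add: S_def T_def n_def sign_matrix_def incidence_matrix_def)
  have S_index: "S $$ (i, j) = (if i = j then if card (xs ! i) = 1 then 1 else -1 else 0)"
    and T_index: "T $$ (i, j) = (if card (xs ! i) \<noteq> 1 \<and> card (xs ! j) = 1 \<and> xs ! j \<subseteq> xs ! i then 1 else 0)"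
    if "i < n" "j < n" for i j
    using that by (simp_all add: S_def T_def n_def sign_matrix_def incidence_matrix_def)
  note index = sign_matrix_mult_index[of _ xs, folded S_def n_def]
  show "S * S = 1\<^sub>m n"
    using S by (intro eq_matI) (simp_all add: index S_index del: index_mult_mat(1))
  show "S * T = - T"
    using S T by (intro eq_matI) (simp_all add: index T_index del: index_mult_mat(1))
  show "T * S = T"
    using S T by (intro eq_matI) (simp_all add: index T_index del: index_mult_mat(1))
  show "T * T = 0\<^sub>m n n"
    by (intro eq_matI) (auto simp: T_def incidence_matrix_def n_def scalar_prod_def intro!: sum.neutral)
qed

text \<open>
  The entry counts the positions of the singletons contained in both simplices, and by closure
  under subsets these are exactly the common vertices.
\<close>

lemma incidence_mult_transpose:
  assumes G: "finite_simplicial_complex (set xs)" and xs: "distinct xs"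
    and i: "i < length xs" and j: "j < length xs"
  shows "(incidence_matrix xs * transpose_mat (incidence_matrix xs)) $$ (i, j)
    = (if card (xs ! i) \<noteq> 1 \<and> card (xs ! j) \<noteq> 1 then real (card (xs ! i \<inter> xs ! j)) else 0)"
proof -
  let ?T = "incidence_matrix xs" and ?n = "length xs"
  define V where "V = {k. k < ?n \<and> card (xs ! k) = 1 \<and> xs ! k \<subseteq> xs ! i \<inter> xs ! j}"
  have "bij_betw (\<lambda>k. the_elem (xs ! k)) V (xs ! i \<inter> xs ! j)"
  proof (rule bij_betw_imageI)
    show "inj_on (\<lambda>k. the_elem (xs ! k)) V"
    proof (rule inj_onI)
      fix k l assume "k \<in> V" "l \<in> V" and kl: "the_elem (xs ! k) = the_elem (xs ! l)"
      then have k: "k < ?n" "card (xs ! k) = 1" and l: "l < ?n" "card (xs ! l) = 1"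
        by (simp_all add: V_def)
      obtain u where "xs ! k = {u}" using k(2) by (rule card_1_singletonE)
      moreover obtain w where "xs ! l = {w}" using l(2) by (rule card_1_singletonE)
      ultimately have "xs ! k = xs ! l" using kl by simp
      then show "k = l" by (rule iffD1[OF nth_eq_iff_index_eq[OF xs k(1) l(1)]])
    qed
    show "(\<lambda>k. the_elem (xs ! k)) ` V = xs ! i \<inter> xs ! j"
    proof (intro equalityI subsetI)
      fix v assume v: "v \<in> xs ! i \<inter> xs ! j"
      have "\<forall>x\<in>set xs. \<forall>y. y \<subseteq> x \<and> y \<noteq> {} \<longrightarrow> y \<in> set xs"
        using G unfolding finite_simplicial_complex_def by (elim conjE)
      from bspec[OF this nth_mem[OF i]] have "{v} \<subseteq> xs ! i \<and> {v} \<noteq> {} \<longrightarrow> {v} \<in> set xs"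
        by (rule spec)
      then have "{v} \<in> set xs"
        using v by simp
      then obtain k where "k < ?n" "xs ! k = {v}"
        by (metis in_set_conv_nth)
      then show "v \<in> (\<lambda>k. the_elem (xs ! k)) ` V"
        using v by (intro rev_image_eqI[of k]) (simp_all add: V_def)
    next
      fix v assume "v \<in> (\<lambda>k. the_elem (xs ! k)) ` V"
      then obtain k where v: "v = the_elem (xs ! k)" and "k \<in> V"
        by (rule imageE)
      then have k: "card (xs ! k) = 1" "xs ! k \<subseteq> xs ! i \<inter> xs ! j"
        by (simp_all add: V_def)
      obtain u where "xs ! k = {u}" using k(1) by (rule card_1_singletonE)
      with k(2) v show "v \<in> xs ! i \<inter> xs ! j" by simp
    qed
  qed
  then have card_V: "card V = card (xs ! i \<inter> xs ! j)"
    by (rule bij_betw_same_card)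
  have "(?T * transpose_mat ?T) $$ (i, j) = (\<Sum>k<?n. ?T $$ (i, k) * ?T $$ (j, k))"
    using i j by (simp add: scalar_prod_def incidence_matrix_def lessThan_atLeast0)
  also have "\<dots> = (\<Sum>k<?n. if card (xs ! i) \<noteq> 1 \<and> card (xs ! j) \<noteq> 1 \<and> k \<in> V then 1 else 0)"
    using i j by (intro sum.cong refl) (simp add: incidence_matrix_def V_def)
  also have "\<dots> = (if card (xs ! i) \<noteq> 1 \<and> card (xs ! j) \<noteq> 1 then real (card V) else 0)"
  proof -
    have "{..<?n} \<inter> V = V" by (auto simp: V_def)
    then show ?thesis by (simp add: sum.If_cases)
  qed
  finally show ?thesis by (simp only: card_V)
qed

text \<open>
  The summands account for different pairs of simplices: \<open>S\<close> for two vertices, \<open>T\<close> and \<open>R\<close> for an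
  edge and a vertex, and \<open>S + T * R\<close> for two edges, where the -1 in \<open>S\<close> corrects the 2 on the diagonal.
  Elsewhere on edges \<open>T * R\<close> has only the entries 0 and 1, because an edge has just two vertices and
  distinct edges share at most one.
\<close>

lemma connection_laplacian_decomposition:
  assumes G: "finite_simplicial_complex (set xs)" and dim: "one_dimensional (set xs)"
    and xs: "distinct xs"
  shows "connection_laplacian xs = sign_matrix xs + incidence_matrix xs
    + transpose_mat (incidence_matrix xs)
    + incidence_matrix xs * transpose_mat (incidence_matrix xs)" (is "?L = ?R")
proof (rule eq_matI)
  fix i j assume "i < dim_row ?R" "j < dim_col ?R"
  then have i: "i < length xs" and j: "j < length xs"
    by (auto simp: incidence_matrix_def)
  have simplex: "finite x \<and> ((\<exists>v. x = {v}) \<or> card x = 2)" if "x \<in> set xs" for x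
  proof -
    have "finite x" "x \<noteq> {}" "card x \<le> 2"
      using that G dim unfolding finite_simplicial_complex_def one_dimensional_def by blast+
    moreover from this have "card x \<noteq> 0" by simp
    ultimately have "finite x" and "card x = 1 \<or> card x = 2" by linarith+
    then show ?thesis by (auto simp: card_1_singleton_iff)
  qed
  note si = simplex[OF nth_mem[OF i]] and sj = simplex[OF nth_mem[OF j]]
  have eq: "xs ! i = xs ! j \<longleftrightarrow> i = j"
    using xs i j by (rule nth_eq_iff_index_eq)
  have edges: "card (xs ! i \<inter> xs ! j) = (if i = j then 2 else if xs ! i \<inter> xs ! j = {} then 0 else 1)"
    if "card (xs ! i) = 2" "card (xs ! j) = 2"
  proof -
    have "xs ! i = xs ! j" if "card (xs ! i \<inter> xs ! j) = 2"
    proof -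
      have "xs ! i \<inter> xs ! j = xs ! i" and "xs ! i \<inter> xs ! j = xs ! j"
        using si sj that \<open>card (xs ! i) = 2\<close> \<open>card (xs ! j) = 2\<close>
        by (intro card_subset_eq; simp)+
      then show ?thesis by simp
    qed
    moreover have "card (xs ! i \<inter> xs ! j) \<le> 2"
      using si that(1) card_mono[of "xs ! i" "xs ! i \<inter> xs ! j"] by simp
    moreover have "card (xs ! i \<inter> xs ! j) = 0 \<longleftrightarrow> xs ! i \<inter> xs ! j = {}"
      using si by simp
    ultimately show ?thesis
      using that(1) eq by (cases "i = j") (auto simp: le_Suc_eq numeral_2_eq_2)
  qed
  have "?R $$ (i, j) = sign_matrix xs $$ (i, j) + incidence_matrix xs $$ (i, j)
      + incidence_matrix xs $$ (j, i)
      + (incidence_matrix xs * transpose_mat (incidence_matrix xs)) $$ (i, j)"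
    using i j by (simp add: incidence_matrix_def sign_matrix_def del: index_mult_mat(1))
  also have "\<dots> = (if xs ! i \<inter> xs ! j \<noteq> {} then 1 else 0)"
  proof -
    consider u v where "xs ! i = {u}" "xs ! j = {v}"
      | u where "xs ! i = {u}" "card (xs ! j) = 2"
      | v where "card (xs ! i) = 2" "xs ! j = {v}"
      | "card (xs ! i) = 2" "card (xs ! j) = 2"
      using si sj by blast
    then show ?thesis
    proof cases
      case 1
      then show ?thesis
        using eq i j unfolding incidence_mult_transpose[OF G xs i j]
        by (auto simp: sign_matrix_def incidence_matrix_def)
    next
      case 2
      then have "i \<noteq> j" by auto
      then show ?thesis
        using 2 i j unfolding incidence_mult_transpose[OF G xs i j]
        by (simp add: sign_matrix_def incidence_matrix_def)
    next
      case 3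
      then have "i \<noteq> j" by auto
      then show ?thesis
        using 3 i j unfolding incidence_mult_transpose[OF G xs i j]
        by (simp add: sign_matrix_def incidence_matrix_def)
    next
      case 4
      then have "xs ! i \<noteq> {}" "xs ! j \<noteq> {}" by auto
      then show ?thesis
        using 4 i j edges[OF 4] unfolding incidence_mult_transpose[OF G xs i j]
        by (simp add: sign_matrix_def incidence_matrix_def)
    qed
  qed
  finally show "?L $$ (i, j) = ?R $$ (i, j)"
    using i j by (simp add: connection_laplacian_def)
qed (auto simp: connection_laplacian_def incidence_matrix_def)

section \<open>The functional equation\<close>

theorem theorem1:
  fixes G :: "'a set set" and xs :: "'a set list" and s :: complex
  assumes "finite_simplicial_complex G"
    and "one_dimensional G"
    and "distinct xs" and "set xs = G"
  shows "spectral_zeta (connection_laplacian xs ^\<^sub>m 2) (- s) =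
         spectral_zeta (connection_laplacian xs ^\<^sub>m 2) s"
proof (rule spectral_zeta_inverse)
  define n where "n = length xs"
  define S where "S = sign_matrix xs"
  define T where "T = incidence_matrix xs"
  define R where "R = transpose_mat T"
  define L where "L = S + T + R + T * R"
  define N where "N = S + T + R - R * T"
  have S: "S \<in> carrier_mat n n" and T: "T \<in> carrier_mat n n" and R: "R \<in> carrier_mat n n"
    by (simp_all add: S_def T_def R_def n_def sign_matrix_def incidence_matrix_def)
  have L: "L \<in> carrier_mat n n" and N: "N \<in> carrier_mat n n"
    using S T R by (auto simp: L_def N_def)
  have T_rel: "S * S = 1\<^sub>m n" "S * T = - T" "T * S = T" "T * T = 0\<^sub>m n n"
    unfolding S_def T_def n_def by (rule sign_matrix_relations)+
  have St: "transpose_mat S = S"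
    by (auto simp: S_def sign_matrix_def)
  \<comment> \<open>Transposing reverses products, so the signs change sides between \<open>T\<close> and \<open>R\<close>.\<close>
  have R_rel: "S * R = R" "R * S = - R" "R * R = 0\<^sub>m n n"
    using T_rel(2-4)[THEN arg_cong[where f = transpose_mat]] S T
    by (simp_all add: transpose_mult[of _ n n _ n] St R_def transpose_uminus)
  note LN = incidence_form_inverse[OF S T R T_rel R_rel, folded L_def N_def]
  have "L * L * (N * N) = L * (L * N) * N"
    using L N by (simp add: assoc_mult_mat[of _ n n _ n _ n])
  also have "\<dots> = 1\<^sub>m n"
    using L LN(1) by simp
  finally have "proots (char_poly (N * N)) = image_mset inverse (proots (char_poly (L * L)))"
    using L N by (intro proots_char_poly_inverse[of _ n]) auto
  moreover have "connection_laplacian xs ^\<^sub>m 2 = L * L"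
    using connection_laplacian_decomposition[of xs] assms L
    by (simp add: numeral_2_eq_2 L_def S_def T_def R_def)
  ultimately show "proots (char_poly (connection_laplacian xs ^\<^sub>m 2))
      = image_mset inverse (proots (char_poly (connection_laplacian xs ^\<^sub>m 2)))"
    using LN(2) by simp
qed

end
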